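(* Let $\boldsymbol{\eta}\in\mathbb{R}^n$ and $\mathbf{f}_1,\dots,\mathbf{f}_M\in\mathbb{R}^n$ be deterministic, $\sigma>0$, and $\mathbf{Y}=\boldsymbol{\eta}+\boldsymbol{\xi}$ with $\boldsymbol{\xi}\sim N(0,\sigma^2\mathbf{I}_n)$. Let $\boldsymbol{\pi}\in\Lambda^M$, $\delta\in(0,1)$. Assume that $\nu\in(0,1)$ and $\omega^2\ge\frac{\sigma^2}{\min(\nu,1-\nu)}$. Then for any $\boldsymbol{\lambda}\in\Lambda^M$, $$\|\boldsymbol{\psi}_X(\omega^2,\nu)-\boldsymbol{\eta}\|_2^2\le\nu\sum_{j=1}^M\lambda_j\|\mathbf{f}_j-\boldsymbol{\eta}\|_2^2+(1-\nu)\|\mathbf{f}_{\boldsymbol{\lambda}}-\boldsymbol{\eta}\|_2^2+2\omega^2\mathcal{K}(\boldsymbol{\lambda},\boldsymbol{\pi}\delta)$$ with probability at least $1-\delta$. Moreover, for any $\boldsymbol{\lambda}\in\Lambda^M$, $$\mathbb{E}\|\boldsymbol{\psi}_X(\omega^2,\nu)-\boldsymbol{\eta}\|_2^2\le\nu\sum_{j=1}^M\lambda_j\|\mathbf{f}_j-\boldsymbol{\eta}\|_2^2+(1-\nu)\|\mathbf{f}_{\boldsymbol{\lambda}}-\boldsymbol{\eta}\|_2^2+2\omega^2\mathcal{K}(\boldsymbol{\lambda},\boldsymbol{\pi})\le\|\mathbf{f}_{\boldsymbol{\lambda}}-\boldsymbol{\eta}\|_2^2+\nu\sum_{j=1}^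M\lambda_j\|\mathbf{f}_j-\mathbf{f}_{\boldsymbol{\lambda}}\|_2^2+2\omega^2\mathcal{K}(\boldsymbol{\lambda},\boldsymbol{\pi}).$$
   Context: $\Lambda^M=\{\boldsymbol{\lambda}\in\mathbb{R}^M:\lambda_j\ge 0,\ \sum_{j=1}^M\lambda_j=1\}$. For $\boldsymbol{\lambda}\in\Lambda^M$, $\mathbf{f}_{\boldsymbol{\lambda}}=\sum_{j=1}^M\lambda_j\mathbf{f}_j$. The Kullback-Leibler divergence is $\mathcal{K}(\boldsymbol{\lambda},\boldsymbol{\pi})=\sum_{j=1}^M\lambda_j\log(\lambda_j/\pi_j)$ (a term with $\lambda_j=0$ equals $0$; a term with $\lambda_j>0$, $\pi_j=0$ equals $+\infty$), and $\mathcal{K}(\boldsymbol{\lambda},\boldsymbol{\pi}\delta)=\sum_{j=1}^M\lambda_j\log(\lambda_j/(\pi_j\delta))=\mathcal{K}(\boldsymbol{\lambda},\boldsymbol{\pi})+\log(1/\delta)$. The BMAX estimator (a function of $\mathbf{Y}$) is $$\boldsymbol{\psi}_X(\omega^2,\nu)=\operatorname*{argmin}_{\boldsymbol{\psi}\in\mathbb{R}^n}J(\boldsymbol{\psi}),\qquad J(\boldsymbol{\psi})=\sum_{j=1}^M\pi_j\exp\left(-\frac{1}{2\omega^2}\|\mathbf{f}_j-\mathbf{Y}\|_2^2+\frac{1-\nu}{2\omega^2}\|\boldsymbol{\psi}-\mathbf{f}_j\|_2^2\right).$$ Probability and expectation are with respect to $\boldsymbol{\xi}$. *)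

theory Defs
  imports "HOL-Probability.Probability"
begin

definition prob_simplex :: "(real ^ 'm) set" where
  "prob_simplex = {l. (\<forall>j. 0 \<le> l $ j) \<and> (\<Sum>j\<in>UNIV. l $ j) = 1}"

definition mixture :: "('m::finite \<Rightarrow> real ^ 'n) \<Rightarrow> real ^ 'm \<Rightarrow> real ^ 'n" where
  "mixture f l = (\<Sum>j\<in>UNIV. (l $ j) *\<^sub>R f j)"

text \<open>
  The second argument need not sum to one: it is also used for a probability vector
  scaled by a constant in (0,1). For nonnegative arguments no summand is \<open>-\<infinity>\<close>.
\<close>

definition kl_div :: "real ^ 'm \<Rightarrow> real ^ 'm \<Rightarrow> ereal" where
  "kl_div l p = (\<Sum>j\<in>UNIV.
     if l $ j = 0 then 0
     else if p $ j = 0 then \<infinity>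
     else ereal (l $ j * ln (l $ j / p $ j)))"

lemma kl_div_scaleR:
  fixes l p :: "real ^ 'm"
  assumes l: "l \<in> prob_simplex" and p: "\<And>j. 0 \<le> p $ j" and d: "0 < d"
  shows "kl_div l (d *\<^sub>R p) = kl_div l p + ereal (ln (1 / d))"
proof -
  have eq: "(if l $ j = 0 then 0 else if (d *\<^sub>R p) $ j = 0 then \<infinity>
               else ereal (l $ j * ln (l $ j / (d *\<^sub>R p) $ j)))
      = (if l $ j = 0 then 0 else if p $ j = 0 then \<infinity>
               else ereal (l $ j * ln (l $ j / p $ j))) + ereal (l $ j * ln (1 / d))" for j
  proof -
    have "l $ j * ln (l $ j / (d * p $ j)) = l $ j * ln (l $ j / p $ j) + l $ j * ln (1 / d)"
      if "l $ j \<noteq> 0" "p $ j \<noteq> 0"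
    proof -
      have "0 < l $ j" "0 < p $ j"
        using that l p[of j] by (auto simp: prob_simplex_def less_le)
      then show ?thesis using d by (simp add: ln_div ln_mult algebra_simps)
    qed
    then show ?thesis using d by auto
  qed
  have "(\<Sum>j\<in>UNIV. l $ j * ln (1 / d)) = ln (1 / d)"
    using l by (simp add: prob_simplex_def flip: sum_distrib_right)
  then show ?thesis
    unfolding kl_div_def eq by (simp add: sum.distrib)
qed

text \<open>The density of the normal distribution with mean \<open>\<mu>\<close> and covariance matrix \<open>\<sigma>\<^sup>2\<close> times the identity.\<close>

definition isotropic_normal_density :: "real ^ 'n \<Rightarrow> real \<Rightarrow> real ^ 'n \<Rightarrow> real" where
  "isotropic_normal_density \<mu> \<sigma> x =
     1 / sqrt (2 * pi * \<sigma>\<^sup>2) ^ CARD('n) * exp (- (norm (x - \<mu>))\<^sup>2 / (2 * \<sigma>\<^sup>2))"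

lemma isotropic_normal_density_eq_prod:
  "isotropic_normal_density \<mu> \<sigma> x = (\<Prod>i\<in>UNIV. normal_density (\<mu> $ i) \<sigma> (x $ i))"
proof -
  have "(norm (x - \<mu>))\<^sup>2 = (\<Sum>i\<in>UNIV. (x $ i - \<mu> $ i)\<^sup>2)"
    unfolding power2_norm_eq_inner inner_vec_def by (simp add: power2_eq_square)
  then have "exp (- (norm (x - \<mu>))\<^sup>2 / (2 * \<sigma>\<^sup>2))
      = (\<Prod>i\<in>UNIV. exp (- (x $ i - \<mu> $ i)\<^sup>2 / (2 * \<sigma>\<^sup>2)))"
    by (simp add: sum_divide_distrib sum_negf flip: exp_sum)
  then show ?thesis
    unfolding isotropic_normal_density_def normal_density_def prod.distrib
    by (simp add: power_one_over)
qed

text \<open>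
  Here and below, the argument \<open>w\<close> stands for \<open>\<omega>\<^sup>2\<close>, not \<open>\<omega>\<close>, and \<open>y\<close> is the observed value of \<open>Y\<close>.
\<close>

definition bmax_objective ::
  "('m::finite \<Rightarrow> real ^ 'n) \<Rightarrow> real ^ 'm \<Rightarrow> real \<Rightarrow> real \<Rightarrow> real ^ 'n \<Rightarrow> real ^ 'n \<Rightarrow> real" where
  "bmax_objective f p w \<nu> y \<psi> =
     (\<Sum>j\<in>UNIV. p $ j * exp (- 1 / (2 * w) * (norm (f j - y))\<^sup>2
                            + (1 - \<nu>) / (2 * w) * (norm (\<psi> - f j))\<^sup>2))"

text \<open>
  If \<open>p\<close> is a probability vector, \<open>w > 0\<close> and \<open>\<nu> < 1\<close>, the objective is continuous, strictly
  convex and coercive in \<open>\<psi>\<close>, so the minimizer exists and is unique.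
\<close>

definition bmax ::
  "('m::finite \<Rightarrow> real ^ 'n) \<Rightarrow> real ^ 'm \<Rightarrow> real \<Rightarrow> real \<Rightarrow> real ^ 'n \<Rightarrow> real ^ 'n" where
  "bmax f p w \<nu> y = arg_min (bmax_objective f p w \<nu> y) (\<lambda>_. True)"

end

theory Submission
  imports Defs
begin

text \<open>
  Let \<open>\<psi>\<close> be the minimizer. The first-order condition says that \<open>\<psi>\<close> is the mixture with weights \<open>q\<close>
  proportional to the summands of the objective at \<open>\<psi>\<close>. Jensen's inequality for \<open>exp\<close>, applied once
  with weights \<open>l\<close> and once with weights \<open>q\<close>, bounds \<open>exp ((excess loss) / (2 \<omega>\<^sup>2))\<close> pointwise by
  \<open>S = \<Sum>\<^sub>j p\<^sub>j exp ((2 \<xi> \<bullet> v\<^sub>j - m \<parallel>v\<^sub>j\<parallel>\<^sup>2) / (2 \<omega>\<^sup>2))\<close> with deterministic vectors \<open>v\<^sub>j = f\<^sub>j - f\<^sub>l\<close> and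
  \<open>m = min \<nu> (1 - \<nu>)\<close>. Since \<open>\<sigma>\<^sup>2 \<le> m \<omega>\<^sup>2\<close>, the Gaussian moment generating function gives \<open>E S \<le> 1\<close>.
  Markov's inequality yields the deviation bound, and \<open>1 + x \<le> exp x\<close> the bound in expectation.
\<close>

section \<open>Jensen's inequality and moment identities for mixtures\<close>

lemma exp_sum_le_sum_exp:
  fixes q b :: "'m::finite \<Rightarrow> real"
  assumes "\<And>j. 0 \<le> q j" and "(\<Sum>j\<in>UNIV. q j) = 1"
  shows "exp (\<Sum>j\<in>UNIV. q j * b j) \<le> (\<Sum>j\<in>UNIV. q j * exp (b j))"
  using convex_on_sum[of UNIV UNIV exp q b] assms exp_convex by auto

text \<open>Gibbs variational inequality: after Jensen with weights \<open>l\<close>, the factor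
  \<open>exp (- ln (l $ j / p $ j))\<close> turns \<open>l $ j\<close> into \<open>p $ j\<close> on
  the support of \<open>l\<close>. Off this support the summand on the left vanishes and the one on
  the right is nonnegative.\<close>

lemma exp_sum_minus_ln_le:
  fixes l p :: "real ^ 'm::finite"
  assumes l: "l \<in> prob_simplex" and p: "\<And>j. 0 \<le> p $ j"
    and supp: "\<And>j. l $ j \<noteq> 0 \<Longrightarrow> p $ j \<noteq> 0"
  shows "exp (\<Sum>j\<in>UNIV. l $ j * (a j - ln (l $ j / p $ j))) \<le> (\<Sum>j\<in>UNIV. p $ j * exp (a j))"
proof -
  have nn: "0 \<le> l $ j" for j using l by (simp add: prob_simplex_def)
  have "exp (\<Sum>j\<in>UNIV. l $ j * (a j - ln (l $ j / p $ j)))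
      \<le> (\<Sum>j\<in>UNIV. l $ j * exp (a j - ln (l $ j / p $ j)))"
    using l by (intro exp_sum_le_sum_exp) (auto simp: prob_simplex_def)
  also have "\<dots> \<le> (\<Sum>j\<in>UNIV. p $ j * exp (a j))"
  proof (rule sum_mono)
    fix j
    show "l $ j * exp (a j - ln (l $ j / p $ j)) \<le> p $ j * exp (a j)"
    proof (cases "l $ j = 0")
      case False
      then have "0 < l $ j" "0 < p $ j"
        using supp nn[of j] p[of j] by (auto simp: less_le)
      then show ?thesis by (simp add: exp_diff)
    qed (simp add: p)
  qed
  finally show ?thesis .
qed

text \<open>Bias-variance decomposition: the cross terms cancel because \<open>mixture f l\<close>
  is the mean of the \<open>f j\<close> under the weights \<open>l\<close>.\<close>

lemma sum_mult_dist_mixture: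
  fixes f :: "'m::finite \<Rightarrow> real ^ 'n"
  assumes "l \<in> prob_simplex"
  shows "(\<Sum>j\<in>UNIV. l $ j * (norm (f j - a))\<^sup>2)
    = (\<Sum>j\<in>UNIV. l $ j * (norm (f j - mixture f l))\<^sup>2) + (norm (mixture f l - a))\<^sup>2"
proof -
  let ?m = "mixture f l"
  have s1: "(\<Sum>j\<in>UNIV. l $ j) = 1" using assms by (simp add: prob_simplex_def)
  have "(\<Sum>j\<in>UNIV. l $ j *\<^sub>R (f j - ?m)) = 0"
    by (simp add: scaleR_diff_right sum_subtractf s1 mixture_def flip: scaleR_left.sum)
  then have c: "(\<Sum>j\<in>UNIV. l $ j * ((f j - ?m) \<bullet> (?m - a))) = 0"
    by (metis (no_types, lifting) inner_scaleR_left inner_sum_left inner_zero_left sum.cong)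
  have "l $ j * (norm (f j - a))\<^sup>2
      = l $ j * (norm (f j - ?m))\<^sup>2 + 2 * (l $ j * ((f j - ?m) \<bullet> (?m - a)))
        + l $ j * (norm (?m - a))\<^sup>2" for j
  proof -
    have "(norm (f j - a))\<^sup>2
        = (norm (f j - ?m))\<^sup>2 + 2 * ((f j - ?m) \<bullet> (?m - a)) + (norm (?m - a))\<^sup>2"
      by (simp add: power2_norm_eq_inner inner_diff inner_commute algebra_simps)
    then show ?thesis by (simp only: distrib_left mult.left_commute)
  qed
  then show ?thesis
    by (simp add: sum.distrib c s1 flip: sum_distrib_left sum_distrib_right)
qed

lemma mixture_diff:
  assumes "l \<in> prob_simplex"
  shows "(\<Sum>j\<in>UNIV. l $ j * (x \<bullet> (f j - a))) = x \<bullet> (mixture f l - a)"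
proof -
  have "(\<Sum>j\<in>UNIV. l $ j) = 1" using assms by (simp add: prob_simplex_def)
  then show ?thesis
    by (simp add: mixture_def inner_diff_right inner_sum_right right_diff_distrib sum_subtractf
        flip: sum_distrib_right)
qed

section \<open>Existence, uniqueness, location and continuity of the minimizer\<close>

lemma bmax_objective_continuous [continuous_intros]:
  assumes "continuous_on S g" "continuous_on S h"
  shows "continuous_on S (\<lambda>x. bmax_objective f p w \<nu> (g x) (h x))"
  unfolding bmax_objective_def by (intro continuous_intros assms)

text \<open>Projecting onto the convex hull decreases the distance to every \<open>f j\<close>.\<close>

lemma bmax_objective_minimizer_exists:
  assumes "0 < w" "\<nu> < 1" "p \<in> prob_simplex"
  shows "\<exists>x\<in>convex hull (range f). \<forall>\<psi>. bmax_objective f p w \<nu> y x \<le> bmax_objective f p w \<nu> y \<psi>"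
proof -
  let ?C = "convex hull (range f)" and ?J = "bmax_objective f p w \<nu> y"
  have C: "compact ?C" "convex ?C" "?C \<noteq> {}"
    by (auto intro: finite_imp_compact_convex_hull)
  then have C': "closed ?C" by (blast intro: compact_imp_closed)
  have "continuous_on ?C ?J" by (intro continuous_intros)
  then obtain x where x: "x \<in> ?C" "\<And>\<psi>. \<psi> \<in> ?C \<Longrightarrow> ?J x \<le> ?J \<psi>"
    using continuous_attains_inf[of ?C ?J] C by blast
  have "?J x \<le> ?J \<psi>" for \<psi>
  proof -
    have "norm (closest_point ?C \<psi> - f j) \<le> norm (\<psi> - f j)" for j
      using closest_point_lipschitz[OF C(2) C' C(3), of \<psi> "f j"]
      by (simp add: closest_point_self hull_inc dist_norm)
    then have "?J (closest_point ?C \<psi>) \<le> ?J \<psi>"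
      unfolding bmax_objective_def using assms
      by (intro sum_mono mult_left_mono)
        (auto simp: prob_simplex_def intro!: mult_left_mono divide_right_mono power_mono)
    moreover have "?J x \<le> ?J (closest_point ?C \<psi>)"
      using C C' by (intro x(2) closest_point_in_set)
    ultimately show ?thesis by linarith
  qed
  with x(1) show ?thesis by blast
qed

text \<open>Strict convexity: at the midpoint of two distinct minimizers the objective would be
  strictly below their common value.\<close>

lemma bmax_objective_minimizer_unique:
  assumes w: "0 < w" "\<nu> < 1" and p: "p \<in> prob_simplex"
    and x: "\<And>\<psi>. bmax_objective f p w \<nu> y x \<le> bmax_objective f p w \<nu> y \<psi>"
    and z: "\<And>\<psi>. bmax_objective f p w \<nu> y z \<le> bmax_objective f p w \<nu> y \<psi>"
  shows "x = z"
proof (rule ccontr)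
  assume ne: "x \<noteq> z"
  let ?J = "bmax_objective f p w \<nu> y"
  define m where "m = (1/2) *\<^sub>R (x + z)"
  define c where "c = (1 - \<nu>) / (2 * w)"
  define e where "e \<psi> j = - 1 / (2 * w) * (norm (f j - y))\<^sup>2 + c * (norm (\<psi> - f j))\<^sup>2" for \<psi> j
  have c: "0 < c" using w by (simp add: c_def)
  have J: "?J \<psi> = (\<Sum>j\<in>UNIV. p $ j * exp (e \<psi> j))" for \<psi>
    by (simp add: bmax_objective_def e_def c_def)
  have pn: "0 \<le> p $ j" for j using p by (simp add: prob_simplex_def)
  have lt: "exp (e m j) < (exp (e x j) + exp (e z j)) / 2" for j
  proof -
    \<comment> \<open>Parallelogram law; its last term is the source of strictness.\<close>
    have "(norm (m - f j))\<^sup>2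
        = ((norm (x - f j))\<^sup>2 + (norm (z - f j))\<^sup>2) / 2 - (norm (x - z))\<^sup>2 / 4"
      by (simp add: m_def power2_norm_eq_inner inner_diff inner_add inner_commute field_simps)
    moreover have "0 < (norm (x - z))\<^sup>2" using ne by simp
    ultimately have "(norm (m - f j))\<^sup>2 < ((norm (x - f j))\<^sup>2 + (norm (z - f j))\<^sup>2) / 2"
      by linarith
    then have "c * (norm (m - f j))\<^sup>2 < c * (((norm (x - f j))\<^sup>2 + (norm (z - f j))\<^sup>2) / 2)"
      using c by (intro mult_strict_left_mono)
    also have "\<dots> = c * (norm (x - f j))\<^sup>2 / 2 + c * (norm (z - f j))\<^sup>2 / 2"
      by (simp add: distrib_left add_divide_distrib)
    finally have "e m j < (1/2) * e x j + (1/2) * e z j"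
      by (simp add: e_def diff_divide_distrib)
    then have "exp (e m j) < exp ((1/2) * e x j + (1/2) * e z j)" by simp
    also have "\<dots> \<le> (1/2) * exp (e x j) + (1/2) * exp (e z j)"
      using convex_onD[OF exp_convex, of "1/2" "e x j" "e z j"] by simp
    finally show ?thesis by simp
  qed
  \<comment> \<open>Individual weights may vanish, so strictness in the sum needs one index of
    positive weight.\<close>
  obtain k where k: "0 < p $ k"
    using p pn by (metis (mono_tags, lifting) less_le mem_Collect_eq prob_simplex_def
        sum.neutral zero_neq_one)
  have "?J m < (\<Sum>j\<in>UNIV. p $ j * ((exp (e x j) + exp (e z j)) / 2))"
    unfolding J
  proof (rule sum_strict_mono_ex1)
    show "\<forall>j\<in>UNIV. p $ j * exp (e m j) \<le> p $ j * ((exp (e x j) + exp (e z j)) / 2)"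
      using mult_left_mono[OF less_imp_le[OF lt] pn] by blast
    show "\<exists>j\<in>UNIV. p $ j * exp (e m j) < p $ j * ((exp (e x j) + exp (e z j)) / 2)"
      using mult_strict_left_mono[OF lt k] by blast
  qed simp
  also have "\<dots> = (?J x + ?J z) / 2"
    by (simp add: J sum.distrib distrib_left add_divide_distrib flip: sum_divide_distrib)
  finally have "?J m + ?J m < ?J x + ?J z" by simp
  with add_mono[OF x[of m] z[of m]] show False by (rule leD[THEN notE])
qed

lemma bmax_objective_bmax_le:
  assumes "0 < w" "\<nu> < 1" "p \<in> prob_simplex"
  shows "bmax_objective f p w \<nu> y (bmax f p w \<nu> y) \<le> bmax_objective f p w \<nu> y \<psi>"
  unfolding bmax_def
  using bmax_objective_minimizer_exists[OF assms, of f y]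
  by (metis (mono_tags, lifting) arg_min_equality)

text \<open>\<open>arg_min\<close> selects some minimizer; by uniqueness it is the one found in the
  hull. The resulting uniform bound on the estimator serves for continuity and for
  integrability.\<close>

lemma bmax_in_convex_hull:
  assumes "0 < w" "\<nu> < 1" "p \<in> prob_simplex"
  shows "bmax f p w \<nu> y \<in> convex hull (range f)"
  using bmax_objective_minimizer_exists[OF assms, of f y] bmax_objective_bmax_le[OF assms, of f y]
    bmax_objective_minimizer_unique[OF assms, of f y]
  by metis

text \<open>Closed graph theorem for maps into the compact hull. Continuity in \<open>y\<close> is
  what makes the estimator measurable.\<close>

lemma continuous_on_bmax:
  fixes f :: "'m::finite \<Rightarrow> real ^ 'n"
  assumes "0 < w" "\<nu> < 1" "p \<in> prob_simplex"
  shows "continuous_on UNIV (bmax f p w \<nu>)"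
proof -
  let ?C = "convex hull (range f)" and ?J = "bmax_objective f p w \<nu>"
  \<comment> \<open>By uniqueness, a pair lies in the graph as soon as its second component is in
    the hull and minimizes; each of these conditions is closed in the pair.\<close>
  have "(\<lambda>y. (y, bmax f p w \<nu> y)) ` UNIV
      = (UNIV \<times> ?C) \<inter> (\<Inter>\<psi>. {z. ?J (fst z) (snd z) \<le> ?J (fst z) \<psi>})" (is "?L = ?R")
  proof
    show "?L \<subseteq> ?R"
      using bmax_in_convex_hull[OF assms] bmax_objective_bmax_le[OF assms] by auto
    show "?R \<subseteq> ?L"
    proof
      fix z assume "z \<in> ?R"
      then have "bmax f p w \<nu> (fst z) = snd z"
        by (intro bmax_objective_minimizer_unique[OF assms bmax_objective_bmax_le[OF assms]]) auto
      then show "z \<in> ?L"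
        by (intro image_eqI[where x = "fst z"]) (simp_all add: prod_eq_iff)
    qed
  qed
  also have "closed \<dots>"
  proof (intro closed_Int closed_Times closed_INT ballI closed_UNIV)
    show "closed ?C"
      by (intro compact_imp_closed finite_imp_compact_convex_hull) simp
    show "closed {z. ?J (fst z) (snd z) \<le> ?J (fst z) \<psi>}" for \<psi>
      by (intro closed_Collect_le continuous_intros)
  qed
  finally have "closed ?L" .
  then have "closedin (top_of_set (UNIV \<times> ?C)) ?L"
    using bmax_in_convex_hull[OF assms] by (intro closed_subset) auto
  then show ?thesis
    using bmax_in_convex_hull[OF assms]
    by (subst continuous_closed_graph_eq[where T = ?C])
      (auto intro: finite_imp_compact_convex_hull)
qed

section \<open>First-order condition and pointwise exponential bound\<close>

text \<open>Up to the positive factor \<open>(1 - \<nu>) / w\<close> the sum is the gradient of the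
  objective, which vanishes at a minimizer.\<close>

lemma sum_scaleR_bmax_diff_eq_0:
  fixes f :: "'m::finite \<Rightarrow> real ^ 'n" and y :: "real ^ 'n"
  assumes w: "0 < w" "\<nu> < 1" and p: "p \<in> prob_simplex"
  defines "\<psi> \<equiv> bmax f p w \<nu> y"
  shows "(\<Sum>j\<in>UNIV. (p $ j * exp (- 1 / (2 * w) * (norm (f j - y))\<^sup>2
      + (1 - \<nu>) / (2 * w) * (norm (\<psi> - f j))\<^sup>2)) *\<^sub>R (\<psi> - f j)) = 0" (is "?g = 0")
proof -
  let ?e = "\<lambda>j. exp (- 1 / (2 * w) * (norm (f j - y))\<^sup>2 + (1 - \<nu>) / (2 * w) * (norm (\<psi> - f j))\<^sup>2)"
  have [derivative_intros]:
    "((\<lambda>\<psi>. (norm (\<psi> - a))\<^sup>2) has_derivative (\<lambda>h. 2 * ((\<psi> - a) \<bullet> h))) (at \<psi>)" for a :: "real ^ 'n"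
    unfolding power2_norm_eq_inner
    by (rule derivative_eq_intros | simp add: inner_commute)+
  have "(bmax_objective f p w \<nu> y has_derivative
      (\<lambda>h. \<Sum>j\<in>UNIV. p $ j * ((1 - \<nu>) / (2 * w) * (2 * ((\<psi> - f j) \<bullet> h)) * ?e j))) (at \<psi>)"
    unfolding bmax_objective_def[abs_def]
    by (intro has_derivative_sum has_derivative_mult_right has_derivative_exp
        has_derivative_add[OF has_derivative_const, simplified add_0] derivative_intros)
  moreover have aux: "a * (b / (2 * w) * (2 * c) * d) = b / w * ((a * d) * c)" for a b c d :: real
    using w by simp
  ultimately have "(\<lambda>h. \<Sum>j\<in>UNIV. p $ j * ((1 - \<nu>) / (2 * w) * (2 * ((\<psi> - f j) \<bullet> h)) * ?e j))
      = (\<lambda>h. 0)"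
    using bmax_objective_bmax_le[OF w p, of f y]
    by (intro differential_zero_maxmin[where S = UNIV]) (auto simp: \<psi>_def)
  \<comment> \<open>The derivative is evaluated in the direction \<open>?g\<close> itself, so that
    it becomes a positive multiple of \<open>?g \<bullet> ?g\<close>.\<close>
  then have "0 = (\<Sum>j\<in>UNIV. p $ j * ((1 - \<nu>) / (2 * w) * (2 * ((\<psi> - f j) \<bullet> ?g)) * ?e j))"
    by metis
  also have "\<dots> = (1 - \<nu>) / w * (?g \<bullet> ?g)"
    unfolding inner_sum_left[of _ _ ?g] sum_distrib_left
    using w by (intro sum.cong refl) (simp only: inner_scaleR_left aux)
  finally show ?thesis using w by auto
qed

text \<open>The right-hand side no longer contains the estimator, so only deterministic directions
  are paired with the noise \<open>y - \<eta>\<close>. The two uses of Jensen contribute the factors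
  \<open>Z\<close> and \<open>?S / Z\<close>, whose product is \<open>?S\<close>.\<close>

lemma exp_bmax_excess_le:
  fixes f :: "'m::finite \<Rightarrow> real ^ 'n" and y \<eta> :: "real ^ 'n" and p l :: "real ^ 'm"
  assumes w: "0 < w" and \<nu>: "\<nu> < 1" and p: "p \<in> prob_simplex" and l: "l \<in> prob_simplex"
    and supp: "\<And>j. l $ j \<noteq> 0 \<Longrightarrow> p $ j \<noteq> 0"
    and m: "m \<le> \<nu>" "m \<le> 1 - \<nu>"
  shows "exp (((norm (bmax f p w \<nu> y - \<eta>))\<^sup>2 - (\<nu> * (\<Sum>j\<in>UNIV. l $ j * (norm (f j - \<eta>))\<^sup>2)
        + (1 - \<nu>) * (norm (mixture f l - \<eta>))\<^sup>2)) / (2 * w) - (\<Sum>j\<in>UNIV. l $ j * ln (l $ j / p $ j)))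
    \<le> (\<Sum>j\<in>UNIV. p $ j * exp ((2 * ((y - \<eta>) \<bullet> (f j - mixture f l))
          - m * (norm (f j - mixture f l))\<^sup>2) / (2 * w)))" (is "exp (?D / (2 * w) - ?K) \<le> ?S")
proof -
  define \<psi> where "\<psi> = bmax f p w \<nu> y"
  let ?fl = "mixture f l"
  \<comment> \<open>Over \<open>2 * w\<close>, \<open>A\<close> gives the exponents of the objective
    at \<open>\<psi>\<close> and \<open>B\<close> those of \<open>?S\<close>; \<open>Z\<close> is
    the minimal value of the objective and \<open>q\<close> its normalized summands.\<close>
  define A where "A j = - (norm (f j - y))\<^sup>2 + (1 - \<nu>) * (norm (f j - \<psi>))\<^sup>2" for j
  define B where "B j = 2 * ((y - \<eta>) \<bullet> (f j - ?fl)) - m * (norm (f j - ?fl))\<^sup>2" for j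
  define Z where "Z = (\<Sum>j\<in>UNIV. p $ j * exp (A j / (2 * w)))"
  define q :: "real ^ 'm" where "q = (\<chi> j. p $ j * exp (A j / (2 * w)) / Z)"
  have pn: "0 \<le> p $ j" for j using p by (simp add: prob_simplex_def)
  \<comment> \<open>The lower bound for \<open>Z\<close> from the variational inequality is an
    exponential, hence \<open>Z\<close> is positive and may be divided by. The same bound later
    gives the factor \<open>Z\<close>.\<close>
  have "0 < exp (\<Sum>j\<in>UNIV. l $ j * (A j / (2 * w) - ln (l $ j / p $ j)))" by simp
  also have Zge: "\<dots> \<le> Z"
    unfolding Z_def by (rule exp_sum_minus_ln_le[OF l pn supp])
  finally have Z: "0 < Z" .
  have q: "q \<in> prob_simplex"
    using Z pn by (auto simp: q_def prob_simplex_def simp flip: sum_divide_distrib Z_def)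
  have A': "A j / (2 * w) = - 1 / (2 * w) * (norm (f j - y))\<^sup>2
      + (1 - \<nu>) / (2 * w) * (norm (\<psi> - f j))\<^sup>2" for j
    using w unfolding A_def norm_minus_commute[of \<psi>] by (simp add: field_simps)
  have "mixture f q = \<psi>"
  proof -
    have "0 = (1 / Z) *\<^sub>R (\<Sum>j\<in>UNIV. (p $ j * exp (A j / (2 * w))) *\<^sub>R (\<psi> - f j))"
      unfolding A' \<psi>_def by (simp only: sum_scaleR_bmax_diff_eq_0[OF w \<nu> p] scaleR_zero_right)
    also have "\<dots> = (\<Sum>j\<in>UNIV. q $ j *\<^sub>R (\<psi> - f j))"
      by (simp add: q_def scaleR_sum_right)
    also have "\<dots> = \<psi> - mixture f q"
      using q by (simp add: mixture_def scaleR_diff_right sum_subtractf prob_simplex_def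
          flip: scaleR_left.sum)
    finally show ?thesis by simp
  qed
  note qsq = sum_mult_dist_mixture[OF q, of f, unfolded this]
    and qin = mixture_diff[OF q, of _ f, unfolded this]
  define V where "V = (\<Sum>j\<in>UNIV. q $ j * (norm (f j - \<psi>))\<^sup>2)"
  define U where "U = (\<Sum>j\<in>UNIV. l $ j * (norm (f j - ?fl))\<^sup>2)"
  have qB: "(\<Sum>j\<in>UNIV. q $ j * B j) = 2 * ((y - \<eta>) \<bullet> (\<psi> - ?fl)) - m * (V + (norm (\<psi> - ?fl))\<^sup>2)"
  proof -
    have "(\<Sum>j\<in>UNIV. q $ j * B j) = 2 * (\<Sum>j\<in>UNIV. q $ j * ((y - \<eta>) \<bullet> (f j - ?fl)))
        - m * (\<Sum>j\<in>UNIV. q $ j * (norm (f j - ?fl))\<^sup>2)"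
      unfolding sum_distrib_left sum_subtractf[symmetric]
      by (intro sum.cong) (auto simp: B_def algebra_simps)
    then show ?thesis by (simp only: qin qsq[of ?fl] V_def)
  qed
  have sA: "(\<Sum>j\<in>UNIV. r $ j * A j) = - (\<Sum>j\<in>UNIV. r $ j * (norm (f j - y))\<^sup>2)
        + (1 - \<nu>) * (\<Sum>j\<in>UNIV. r $ j * (norm (f j - \<psi>))\<^sup>2)" for r :: "real ^ 'm"
    unfolding sum_distrib_left sum_negf[symmetric] sum.distrib[symmetric]
    by (intro sum.cong) (auto simp: A_def algebra_simps)
  have qA: "(\<Sum>j\<in>UNIV. q $ j * A j) = - (V + (norm (\<psi> - y))\<^sup>2) + (1 - \<nu>) * V"
    unfolding sA qsq[of y] V_def by simp
  have lA: "(\<Sum>j\<in>UNIV. l $ j * A j) = - (U + (norm (?fl - y))\<^sup>2) + (1 - \<nu>) * (U + (norm (?fl - \<psi>))\<^sup>2)"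
    unfolding sA sum_mult_dist_mixture[OF l, of f y] sum_mult_dist_mixture[OF l, of f \<psi>] U_def by simp
  have D: "?D = (norm (\<psi> - \<eta>))\<^sup>2 - \<nu> * U - (norm (?fl - \<eta>))\<^sup>2"
    unfolding sum_mult_dist_mixture[OF l, of f \<eta>] U_def \<psi>_def by (simp add: algebra_simps)
  \<comment> \<open>Moving the reference point from \<open>y\<close> to \<open>\<eta>\<close>
    produces exactly the noise term that occurs in \<open>qB\<close>.\<close>
  have polar: "(norm (\<psi> - y))\<^sup>2 - (norm (?fl - y))\<^sup>2 + 2 * ((y - \<eta>) \<bullet> (\<psi> - ?fl))
      = (norm (\<psi> - \<eta>))\<^sup>2 - (norm (?fl - \<eta>))\<^sup>2"
    by (simp add: power2_norm_eq_inner inner_diff inner_commute algebra_simps)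
  \<comment> \<open>The right-hand side of \<open>le\<close> exceeds \<open>?D\<close> by exactly
    the sum of these two terms. This is where both bounds on \<open>m\<close> enter.\<close>
  have "0 \<le> (\<nu> - m) * V" "0 \<le> (1 - \<nu> - m) * (norm (\<psi> - ?fl))\<^sup>2"
    using q m unfolding V_def by (auto simp: prob_simplex_def intro!: mult_nonneg_nonneg sum_nonneg)
  then have le: "?D \<le> (\<Sum>j\<in>UNIV. q $ j * B j) - (\<Sum>j\<in>UNIV. q $ j * A j) + (\<Sum>j\<in>UNIV. l $ j * A j)"
    using polar unfolding D qA lA qB norm_minus_commute[of ?fl \<psi>]
    by (simp add: algebra_simps)
  have "?D / (2 * w) - ?K
      \<le> ((\<Sum>j\<in>UNIV. q $ j * B j) - (\<Sum>j\<in>UNIV. q $ j * A j) + (\<Sum>j\<in>UNIV. l $ j * A j)) / (2 * w) - ?K"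
    using le w by (simp add: divide_right_mono)
  also have "\<dots> = (\<Sum>j\<in>UNIV. q $ j * (B j / (2 * w) - A j / (2 * w)))
      + (\<Sum>j\<in>UNIV. l $ j * (A j / (2 * w) - ln (l $ j / p $ j)))"
    by (simp add: right_diff_distrib sum_subtractf add_divide_distrib diff_divide_distrib
        flip: sum_divide_distrib)
  finally have "exp (?D / (2 * w) - ?K) \<le> exp (\<Sum>j\<in>UNIV. q $ j * (B j / (2 * w) - A j / (2 * w)))
      * exp (\<Sum>j\<in>UNIV. l $ j * (A j / (2 * w) - ln (l $ j / p $ j)))"
    by (simp flip: exp_add)
  also have "\<dots> \<le> (\<Sum>j\<in>UNIV. q $ j * exp (B j / (2 * w) - A j / (2 * w))) * Z"
    using q by (intro mult_mono Zge exp_sum_le_sum_exp sum_nonneg mult_nonneg_nonneg)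
      (auto simp: prob_simplex_def)
  also have "\<dots> = ?S"
    unfolding sum_distrib_right using Z by (intro sum.cong) (auto simp: q_def B_def exp_diff)
  finally show ?thesis .
qed

section \<open>Gaussian moment generating function\<close>

text \<open>Completing the square: tilting the density by \<open>exp (x \<bullet> u)\<close>
  translates it by \<open>?c\<close> and multiplies it by the claimed value; Lebesgue measure is
  translation invariant.\<close>

lemma has_bochner_integral_exp_isotropic_normal:
  fixes \<xi> :: "'w \<Rightarrow> real ^ 'n"
  assumes P: "prob_space P" and \<sigma>: "0 < \<sigma>"
    and \<xi>: "distributed P lborel \<xi> (isotropic_normal_density 0 \<sigma>)"
  shows "has_bochner_integral P (\<lambda>x. exp (\<xi> x \<bullet> u)) (exp (\<sigma>\<^sup>2 * (norm u)\<^sup>2 / 2))"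
proof -
  interpret prob_space P by fact
  let ?d = "isotropic_normal_density (0 :: real ^ 'n) \<sigma>" and ?c = "\<sigma>\<^sup>2 *\<^sub>R u"
  have dn: "0 \<le> ?d x" for x by (simp add: isotropic_normal_density_def)
  have dm[measurable]: "?d \<in> borel_measurable borel"
    unfolding isotropic_normal_density_def[abs_def] by measurable
  \<comment> \<open>That the density has total mass one is read off from \<open>P\<close> being a
    probability measure, by transferring the constant function 1.\<close>
  have "integrable lborel ?d"
    using distributed_integrable[OF \<xi>, of "\<lambda>_. 1"] dn by simp
  moreover have "integral\<^sup>L lborel ?d = 1"
    using distributed_integral[OF \<xi>, of "\<lambda>_. 1"] dn by (simp add: prob_space)
  ultimately have one: "integrable lborel (\<lambda>x. ?d (- ?c + x))"
      "integral\<^sup>L lborel (\<lambda>x. ?d (- ?c + x)) = 1"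
    using integrable_distr_eq[of "(+) (- ?c)" lborel borel ?d]
      integral_distr[of "(+) (- ?c)" lborel borel ?d]
    by (simp_all add: lborel_distr_plus)
  have eq: "?d x * exp (x \<bullet> u) = exp (\<sigma>\<^sup>2 * (norm u)\<^sup>2 / 2) * ?d (- ?c + x)" for x
  proof -
    have "(norm (- ?c + x))\<^sup>2 = (norm x)\<^sup>2 - 2 * \<sigma>\<^sup>2 * (x \<bullet> u) + \<sigma>\<^sup>2 * (\<sigma>\<^sup>2 * (norm u)\<^sup>2)"
      unfolding power2_norm_eq_inner by (simp add: inner_diff inner_commute algebra_simps)
    moreover have "- a / (2 * s) + b = s * c / 2 + - (a - 2 * s * b + s * (s * c)) / (2 * s)"
      if "0 < s" for a b c s :: real
      using that by (simp add: field_simps)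
    ultimately have "- (norm x)\<^sup>2 / (2 * \<sigma>\<^sup>2) + x \<bullet> u
        = \<sigma>\<^sup>2 * (norm u)\<^sup>2 / 2 + (- (norm (- ?c + x))\<^sup>2 / (2 * \<sigma>\<^sup>2))"
      using \<sigma> by (metis zero_less_power)
    then have "exp (- (norm x)\<^sup>2 / (2 * \<sigma>\<^sup>2)) * exp (x \<bullet> u)
        = exp (\<sigma>\<^sup>2 * (norm u)\<^sup>2 / 2) * exp (- (norm (- ?c + x))\<^sup>2 / (2 * \<sigma>\<^sup>2))"
      by (metis exp_add)
    then show ?thesis by (simp add: isotropic_normal_density_def mult.assoc mult.left_commute)
  qed
  have "integrable P (\<lambda>x. exp (\<xi> x \<bullet> u))"
    using one dn by (subst distributed_integrable[OF \<xi>, symmetric]) (auto simp: eq)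
  moreover have "integral\<^sup>L P (\<lambda>x. exp (\<xi> x \<bullet> u)) = exp (\<sigma>\<^sup>2 * (norm u)\<^sup>2 / 2)"
    using one dn by (subst distributed_integral[OF \<xi>, symmetric]) (auto simp: eq)
  ultimately show ?thesis by (simp add: has_bochner_integral_iff)
qed

section \<open>Finite and infinite Kullback-Leibler divergence\<close>

lemma kl_div_eq_sum:
  assumes "\<And>j. l $ j \<noteq> 0 \<Longrightarrow> p $ j \<noteq> 0"
  shows "kl_div l p = ereal (\<Sum>j\<in>UNIV. l $ j * ln (l $ j / p $ j))"
  unfolding kl_div_def sum_ereal[symmetric] using assms by (intro sum.cong) auto

lemma kl_div_eq_PInf:
  assumes "l $ j \<noteq> 0" "p $ j = 0"
  shows "kl_div l p = \<infinity>"
  unfolding kl_div_def sum_Pinfty using assms by auto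

section \<open>Deviation bound and bound in expectation\<close>

theorem corollary1:
  fixes P :: "'w measure"
    and \<xi> Y :: "'w \<Rightarrow> real ^ 'n"
    and \<eta> :: "real ^ 'n"
    and f :: "'m::finite \<Rightarrow> real ^ 'n"
    and p :: "real ^ 'm"
    and \<sigma> \<omega> \<nu> \<delta> :: real
  assumes "prob_space P"
    and "\<sigma> > 0"
    and "distributed P lborel \<xi> (isotropic_normal_density 0 \<sigma>)"
    and "\<And>w. Y w = \<eta> + \<xi> w"
    and "p \<in> prob_simplex"
    and "0 < \<delta>" and "\<delta> < 1"
    and "0 < \<nu>" and "\<nu> < 1"
    and "\<omega>\<^sup>2 \<ge> \<sigma>\<^sup>2 / min \<nu> (1 - \<nu>)"
  shows "(\<forall>l \<in> prob_simplex.
            measure P {w \<in> space P.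
              ereal ((norm (bmax f p (\<omega>\<^sup>2) \<nu> (Y w) - \<eta>))\<^sup>2)
                \<le> ereal (\<nu> * (\<Sum>j\<in>UNIV. l $ j * (norm (f j - \<eta>))\<^sup>2)
                          + (1 - \<nu>) * (norm (mixture f l - \<eta>))\<^sup>2)
                  + ereal (2 * \<omega>\<^sup>2) * kl_div l (\<delta> *\<^sub>R p)}
            \<ge> 1 - \<delta>)
       \<and> integrable P (\<lambda>w. (norm (bmax f p (\<omega>\<^sup>2) \<nu> (Y w) - \<eta>))\<^sup>2)
       \<and> (\<forall>l \<in> prob_simplex.
            ereal (\<integral>w. (norm (bmax f p (\<omega>\<^sup>2) \<nu> (Y w) - \<eta>))\<^sup>2 \<partial>P)
              \<le> ereal (\<nu> * (\<Sum>j\<in>UNIV. l $ j * (norm (f j - \<eta>))\<^sup>2)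
                        + (1 - \<nu>) * (norm (mixture f l - \<eta>))\<^sup>2)
                + ereal (2 * \<omega>\<^sup>2) * kl_div l p
          \<and> ereal (\<nu> * (\<Sum>j\<in>UNIV. l $ j * (norm (f j - \<eta>))\<^sup>2)
                    + (1 - \<nu>) * (norm (mixture f l - \<eta>))\<^sup>2)
              + ereal (2 * \<omega>\<^sup>2) * kl_div l p
              \<le> ereal ((norm (mixture f l - \<eta>))\<^sup>2
                        + \<nu> * (\<Sum>j\<in>UNIV. l $ j * (norm (f j - mixture f l))\<^sup>2))
                + ereal (2 * \<omega>\<^sup>2) * kl_div l p)"
proof -
  interpret prob_space P by fact
  have \<sigma>: "0 < \<sigma>" and \<delta>: "0 < \<delta>" "\<delta> < 1" and \<nu>: "0 < \<nu>" "\<nu> < 1"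
    and p: "p \<in> prob_simplex" and \<xi>: "distributed P lborel \<xi> (isotropic_normal_density 0 \<sigma>)"
    and Y: "\<And>w. Y w = \<eta> + \<xi> w"
    by fact+
  define m where "m = min \<nu> (1 - \<nu>)"
  have m: "0 < m" "m \<le> \<nu>" "m \<le> 1 - \<nu>" using \<nu> by (auto simp: m_def)
  define W where "W = \<omega>\<^sup>2"
  have Wm: "\<sigma>\<^sup>2 \<le> m * W"
    using \<open>\<omega>\<^sup>2 \<ge> \<sigma>\<^sup>2 / min \<nu> (1 - \<nu>)\<close> m(1) by (simp add: m_def[symmetric] W_def field_simps)
  have W: "0 < W"
    using Wm \<sigma> m(1) by (smt (verit) zero_less_mult_pos zero_less_power)
  have pn: "0 \<le> p $ j" for j using p by (simp add: prob_simplex_def)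
  have p1: "(\<Sum>j\<in>UNIV. p $ j) = 1" using p by (simp add: prob_simplex_def)
  define R where "R w = (norm (bmax f p W \<nu> (Y w) - \<eta>))\<^sup>2" for w
  have [measurable]: "\<xi> \<in> borel_measurable P" using distributed_measurable[OF \<xi>] by simp
  then have Ym[measurable]: "Y \<in> borel_measurable P" unfolding Y[abs_def] by measurable
  have [measurable]: "bmax f p W \<nu> \<in> borel_measurable borel"
    by (intro borel_measurable_continuous_onI continuous_on_bmax W \<nu> p)
  have Rm[measurable]: "R \<in> borel_measurable P" unfolding R_def by measurable
  \<comment> \<open>The estimator takes values in a bounded hull, so the loss is bounded.\<close>
  have Rint: "integrable P R"
  proof -
    have "bounded (convex hull (range f))"
      by (intro compact_imp_bounded finite_imp_compact_convex_hull) simp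
    then obtain B where B: "\<And>x. x \<in> convex hull (range f) \<Longrightarrow> norm x \<le> B"
      by (auto simp: bounded_iff)
    have "R w \<le> (B + norm \<eta>)\<^sup>2" for w
      unfolding R_def using B[OF bmax_in_convex_hull[OF W \<nu>(2) p]]
      by (intro power_mono norm_ge_zero order_trans[OF norm_triangle_ineq4]) auto
    then show ?thesis
      by (intro integrable_const_bound[where B = "(B + norm \<eta>)\<^sup>2"]) (auto simp: R_def)
  qed
  define T where "T l = \<nu> * (\<Sum>j\<in>UNIV. l $ j * (norm (f j - \<eta>))\<^sup>2)
      + (1 - \<nu>) * (norm (mixture f l - \<eta>))\<^sup>2" for l
  define S where "S l w = (\<Sum>j\<in>UNIV. p $ j * exp ((2 * (\<xi> w \<bullet> (f j - mixture f l))
          - m * (norm (f j - mixture f l))\<^sup>2) / (2 * W)))" for l w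
  have S: "integrable P (S l)" "expectation (S l) \<le> 1" for l
  proof -
    \<comment> \<open>The moment generating function is taken at \<open>u = v / W\<close>. The
      resulting exponent is nonpositive because \<open>\<sigma>\<^sup>2 \<le> m * W\<close>.\<close>
    have bi: "has_bochner_integral P (\<lambda>w. exp ((2 * (\<xi> w \<bullet> v) - m * (norm v)\<^sup>2) / (2 * W)))
        (exp ((\<sigma>\<^sup>2 / W - m) * (norm v)\<^sup>2 / (2 * W)))" for v
    proof -
      have "has_bochner_integral P (\<lambda>w. exp (\<xi> w \<bullet> ((1 / W) *\<^sub>R v)) * exp (- m * (norm v)\<^sup>2 / (2 * W)))
          (exp (\<sigma>\<^sup>2 * (norm ((1 / W) *\<^sub>R v))\<^sup>2 / 2) * exp (- m * (norm v)\<^sup>2 / (2 * W)))"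
        by (intro has_bochner_integral_mult_left
            has_bochner_integral_exp_isotropic_normal[OF _ \<sigma> \<xi>] prob_space_axioms)
      also have "(\<lambda>w. exp (\<xi> w \<bullet> ((1 / W) *\<^sub>R v)) * exp (- m * (norm v)\<^sup>2 / (2 * W)))
          = (\<lambda>w. exp ((2 * (\<xi> w \<bullet> v) - m * (norm v)\<^sup>2) / (2 * W)))"
        by (simp add: diff_divide_distrib flip: exp_add)
      also have "exp (\<sigma>\<^sup>2 * (norm ((1 / W) *\<^sub>R v))\<^sup>2 / 2) * exp (- m * (norm v)\<^sup>2 / (2 * W))
          = exp ((\<sigma>\<^sup>2 / W - m) * (norm v)\<^sup>2 / (2 * W))"
        using W by (simp add: power2_eq_square field_simps flip: exp_add)
      finally show ?thesis .
    qed
    have le1: "exp ((\<sigma>\<^sup>2 / W - m) * (norm v)\<^sup>2 / (2 * W)) \<le> 1" for v :: "real ^ 'n"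
    proof -
      have "\<sigma>\<^sup>2 / W - m \<le> 0" using Wm W by (simp add: field_simps)
      then show ?thesis using W by (auto intro!: divide_nonpos_pos mult_nonpos_nonneg)
    qed
    have b: "has_bochner_integral P (S l)
        (\<Sum>j\<in>UNIV. p $ j * exp ((\<sigma>\<^sup>2 / W - m) * (norm (f j - mixture f l))\<^sup>2 / (2 * W)))"
      unfolding S_def by (intro has_bochner_integral_sum has_bochner_integral_mult_right bi)
    have "(\<Sum>j\<in>UNIV. p $ j * exp ((\<sigma>\<^sup>2 / W - m) * (norm (f j - mixture f l))\<^sup>2 / (2 * W)))
        \<le> (\<Sum>j\<in>UNIV. p $ j * 1)"
      by (intro sum_mono mult_left_mono le1 pn)
    with b show "integrable P (S l)" "expectation (S l) \<le> 1"
      by (auto simp: has_bochner_integral_iff p1)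
  qed
  have Sn: "0 \<le> S l w" for l w
    unfolding S_def by (intro sum_nonneg mult_nonneg_nonneg pn) auto
  have key: "exp ((R w - T l) / (2 * W) - (\<Sum>j\<in>UNIV. l $ j * ln (l $ j / p $ j))) \<le> S l w"
    if "l \<in> prob_simplex" "\<And>j. l $ j \<noteq> 0 \<Longrightarrow> p $ j \<noteq> 0" for l w
    using exp_bmax_excess_le[OF W \<nu>(2) p that m(2,3), where y = "Y w" and \<eta> = \<eta> and f = f]
    by (simp add: R_def T_def S_def Y)
  have inf_kl: "kl_div l p = \<infinity>" if "l $ j \<noteq> 0" "p $ j = 0" for l j
    using that by (rule kl_div_eq_PInf)
  have prob: "1 - \<delta> \<le> prob {w \<in> space P. ereal (R w) \<le> ereal (T l) + ereal (2 * W) * kl_div l (\<delta> *\<^sub>R p)}"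
    if l: "l \<in> prob_simplex" for l
  proof (cases "\<forall>j. l $ j \<noteq> 0 \<longrightarrow> p $ j \<noteq> 0")
    case True
    define K where "K = (\<Sum>j\<in>UNIV. l $ j * ln (l $ j / p $ j))"
    have kl: "kl_div l (\<delta> *\<^sub>R p) = ereal (K + ln (1 / \<delta>))"
      using kl_div_scaleR[OF l pn \<delta>(1)] kl_div_eq_sum[of l p] True by (simp add: K_def)
    let ?E = "{w \<in> space P. R w \<le> T l + 2 * W * (K + ln (1 / \<delta>))}"
    \<comment> \<open>If the bound fails, the exponent in \<open>key\<close> is at least
      \<open>ln (1 / \<delta>)\<close>, the amount by which scaling \<open>p\<close> by
      \<open>\<delta>\<close> raises the divergence. Thus \<open>S l\<close> reaches
      \<open>1 / \<delta>\<close>, and Markov's inequality applies at this level.\<close>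
    have "prob (space P - ?E) \<le> prob {w \<in> space P. 1 / \<delta> \<le> S l w}"
    proof (rule finite_measure_mono)
      show "space P - ?E \<subseteq> {w \<in> space P. 1 / \<delta> \<le> S l w}"
      proof clarsimp
        fix w assume "\<not> R w \<le> T l + 2 * W * (K + ln (1 / \<delta>))"
        then have "ln (1 / \<delta>) \<le> (R w - T l) / (2 * W) - K"
          using W by (simp add: field_simps)
        then have "exp (ln (1 / \<delta>)) \<le> exp ((R w - T l) / (2 * W) - K)" by (subst exp_le_cancel_iff)
        also have "\<dots> \<le> S l w" using key[OF l] True by (simp add: K_def)
        finally show "1 / \<delta> \<le> S l w" using \<delta> by simp
      qed
      show "{w \<in> space P. 1 / \<delta> \<le> S l w} \<in> sets P"
        using borel_measurable_integrable[OF S(1)[of l]] by measurable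
    qed
    also have "\<dots> \<le> expectation (S l) / (1 / \<delta>)"
      using \<delta> Sn by (intro integral_Markov_inequality_measure[where A = "space P"] S) auto
    also have "\<dots> \<le> \<delta>"
      using S(2)[of l] \<delta> by (simp add: mult_left_le_one_le mult_le_cancel_right1)
    finally have "1 - \<delta> \<le> prob ?E"
      by (subst (asm) prob_compl) auto
    then show ?thesis by (simp add: kl)
  next
    \<comment> \<open>The divergence is infinite, so the event is the whole space.\<close>
    case False
    then have "kl_div l (\<delta> *\<^sub>R p) = \<infinity>"
      using kl_div_scaleR[OF l pn \<delta>(1)] inf_kl[of l] by auto
    then show ?thesis using W \<delta> by (simp add: prob_space)
  qed
  have expect: "ereal (expectation R) \<le> ereal (T l) + ereal (2 * W) * kl_div l p"
    if l: "l \<in> prob_simplex" for l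
  proof (cases "\<forall>j. l $ j \<noteq> 0 \<longrightarrow> p $ j \<noteq> 0")
    case True
    define K where "K = (\<Sum>j\<in>UNIV. l $ j * ln (l $ j / p $ j))"
    \<comment> \<open>Linearizing \<open>key\<close> by \<open>1 + x \<le> exp x\<close> leaves the
      remainder \<open>2 * W * (S l w - 1)\<close>, whose expectation is nonpositive.\<close>
    have "R w \<le> T l + 2 * W * K + 2 * W * (S l w - 1)" for w
    proof -
      have "1 + ((R w - T l) / (2 * W) - K) \<le> S l w"
        using exp_ge_add_one_self key[OF l, of w] True unfolding K_def by (blast intro: order_trans)
      then show ?thesis using W by (simp add: field_simps)
    qed
    then have "expectation R \<le> expectation (\<lambda>w. T l + 2 * W * K + 2 * W * (S l w - 1))"
      using S(1) Rint by (intro integral_mono) auto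
    also have "\<dots> = T l + 2 * W * K + 2 * W * (expectation (S l) - 1)"
      using S(1) by (simp add: prob_space)
    also have "\<dots> \<le> T l + 2 * W * K"
      using S(2)[of l] W by (simp add: mult_nonneg_nonpos)
    finally show ?thesis using kl_div_eq_sum[of l p] True by (simp add: K_def)
  next
    case False
    then show ?thesis using inf_kl[of l] W by auto
  qed
  \<comment> \<open>The second inequality of the chain holds with equality, by the bias-variance
    decomposition about \<open>\<eta>\<close>.\<close>
  have "T l = (norm (mixture f l - \<eta>))\<^sup>2 + \<nu> * (\<Sum>j\<in>UNIV. l $ j * (norm (f j - mixture f l))\<^sup>2)"
    if "l \<in> prob_simplex" for l
    unfolding T_def sum_mult_dist_mixture[OF that, of f \<eta>] by (simp add: algebra_simps)
  then show ?thesis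
    using prob Rint expect unfolding R_def[abs_def] T_def W_def by (simp add: order_refl)
qed

end
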